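(* There exists a regular finite simple connected undirected graph on $10$ vertices containing two vertices that are cospectral but not similar, and no regular finite simple connected undirected graph on fewer than $10$ vertices contains two vertices that are cospectral but not similar.
   Context: A graph is regular if all vertices have the same degree. For a finite simple graph with adjacency matrix $A$, let $\phi_1,\dots,\phi_n$ be a real orthonormal eigenbasis of $A$ with $A\phi_j=\lambda_j\phi_j$. Two vertices $a,b$ are cospectral if $\sum_{j:\lambda_j=\lambda}|\phi_j(a)|^2=\sum_{j:\lambda_j=\lambda}|\phi_j(b)|^2$ for every eigenvalue $\lambda$ (equivalently, $(A^k)_{a,a}=(A^k)_{b,b}$ for all $k\ge 0$). Two vertices are similar if some graph automorphism maps one to the other. *)

theory Defs
  imports Complex_Main "Graph_Theory.Graph_Theory"
begin

text \<open>
  A finite simple undirected graph is a \<^locale>\<open>pair_graph\<close>: a finite vertex set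
  \<^term>\<open>pverts G\<close> with a symmetric irreflexive arc relation \<^term>\<open>parcs G\<close> on it. Each
  undirected edge is represented by its two orientations, so the degree of a vertex is its
  out-degree.
\<close>

definition regular_graph :: "'a pair_pre_digraph \<Rightarrow> bool" where
  "regular_graph G \<longleftrightarrow> (\<exists>k. \<forall>v \<in> pverts G. out_degree (with_proj G) v = k)"

definition adj_matrix :: "'a pair_pre_digraph \<Rightarrow> 'a \<Rightarrow> 'a \<Rightarrow> real" where
  "adj_matrix G u v = (if (u, v) \<in> parcs G then 1 else 0)"

text \<open>
  \<^term>\<open>\<phi> j\<close> for \<^term>\<open>j < card (pverts G)\<close> are the members of the eigenbasis, as functions on
  the vertices, and \<^term>\<open>lam j\<close> are the corresponding eigenvalues. Spanning need not be
  required: the number of orthonormal vectors equals the dimension.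
\<close>

definition orthonormal_eigenbasis ::
    "'a pair_pre_digraph \<Rightarrow> (nat \<Rightarrow> 'a \<Rightarrow> real) \<Rightarrow> (nat \<Rightarrow> real) \<Rightarrow> bool" where
  "orthonormal_eigenbasis G \<phi> lam \<longleftrightarrow>
     (\<forall>i < card (pverts G). \<forall>j < card (pverts G).
        (\<Sum>v \<in> pverts G. \<phi> i v * \<phi> j v) = (if i = j then 1 else 0)) \<and>
     (\<forall>j < card (pverts G). \<forall>u \<in> pverts G.
        (\<Sum>v \<in> pverts G. adj_matrix G u v * \<phi> j v) = lam j * \<phi> j u)"

text \<open>
  The sums below are diagonal entries of the orthogonal projections onto the eigenspaces, hence
  independent of the eigenbasis; and every finite graph has an eigenbasis since its adjacency
  matrix is real symmetric. So quantifying the eigenbasis existentially or universally is the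
  same. The eigenvalues of the matrix are exactly the numbers \<^term>\<open>lam j\<close>.
\<close>

definition cospectral_vertices :: "'a pair_pre_digraph \<Rightarrow> 'a \<Rightarrow> 'a \<Rightarrow> bool" where
  "cospectral_vertices G a b \<longleftrightarrow>
     (\<exists>\<phi> lam. orthonormal_eigenbasis G \<phi> lam \<and>
        (\<forall>\<mu> \<in> lam ` {..<card (pverts G)}.
           (\<Sum>j | j < card (pverts G) \<and> lam j = \<mu>. \<bar>\<phi> j a\<bar>\<^sup>2) =
           (\<Sum>j | j < card (pverts G) \<and> lam j = \<mu>. \<bar>\<phi> j b\<bar>\<^sup>2)))"

definition graph_automorphism :: "'a pair_pre_digraph \<Rightarrow> ('a \<Rightarrow> 'a) \<Rightarrow> bool" where
  "graph_automorphism G f \<longleftrightarrow>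
     bij_betw f (pverts G) (pverts G) \<and>
     (\<forall>u \<in> pverts G. \<forall>v \<in> pverts G. (f u, f v) \<in> parcs G \<longleftrightarrow> (u, v) \<in> parcs G)"

definition similar_vertices :: "'a pair_pre_digraph \<Rightarrow> 'a \<Rightarrow> 'a \<Rightarrow> bool" where
  "similar_vertices G a b \<longleftrightarrow> (\<exists>f. graph_automorphism G f \<and> f a = b)"

end

theory Submission
  imports Defs "HOL-Library.Multiset"
begin

text \<open>
  On 10 vertices, join 0 to 1, 2, 3, join each \<open>i\<close> of these to \<open>i + 3\<close> and \<open>i + 6\<close>, and add the
  triangles 4, 5, 6 and 7, 8, 9. This cubic graph has an integral eigenbasis, from which 0 and 1 are
  seen to be cospectral; but 1 has a neighbour in a triangle and 0 has none.

  On at most 9 vertices, cospectral vertices have the same number of closed walks of every length. Up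
  to isomorphism, the regular graphs with a chosen root are few: choosing the neighbours of one vertex
  after the other, starting with the root, one may permute the vertices that have not yet been told
  apart. In each of these graphs, a computation finds for every vertex either a length at
  most 7 at which its number of closed walks differs from that of the root, or an automorphism that
  maps the root to it.
\<close>

section \<open>Cospectral vertices and closed walks\<close>

text \<open>Walks grow at the end \<open>v\<close>: for fixed \<open>u\<close>, each step multiplies
  a vector by the adjacency matrix, which is the iteration in \<open>walks_differ\<close>.\<close>

primrec nwalks :: "'a set \<Rightarrow> ('a \<Rightarrow> 'a \<Rightarrow> bool) \<Rightarrow> nat \<Rightarrow> 'a \<Rightarrow> 'a \<Rightarrow> int" where
  "nwalks V E 0 u v = of_bool (u = v)"
| "nwalks V E (Suc m) u v = (\<Sum>w | w \<in> V \<and> E v w. nwalks V E m u w)"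

text \<open>\<open>P\<close> is the Gram matrix of the columns and a projection; the squared entries
  of the identity minus \<open>P\<close> add up to \<open>card V\<close> minus the trace of
  \<open>P\<close>, which is 0. So a square matrix with orthonormal rows has orthonormal
  columns.\<close>

lemma orthonormal_complete:
  fixes \<phi> :: "nat \<Rightarrow> 'a \<Rightarrow> real"
  assumes fin: "finite V"
    and orth: "\<And>i j. i < card V \<Longrightarrow> j < card V \<Longrightarrow> (\<Sum>v\<in>V. \<phi> i v * \<phi> j v) = of_bool (i = j)"
    and uv: "u \<in> V" "v \<in> V"
  shows "(\<Sum>j<card V. \<phi> j u * \<phi> j v) = of_bool (u = v)"
proof -
  define P where "P = (\<lambda>u v. \<Sum>j<card V. \<phi> j u * \<phi> j v)"
  have proj: "(\<Sum>w\<in>V. P u w * P v w) = P u v" for u v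
  proof -
    have "(\<Sum>w\<in>V. P u w * P v w)
        = (\<Sum>w\<in>V. \<Sum>i<card V. \<Sum>j<card V. (\<phi> i u * \<phi> j v) * (\<phi> i w * \<phi> j w))"
      by (simp add: P_def sum_product mult_ac)
    also have "\<dots> = (\<Sum>i<card V. \<Sum>j<card V. \<Sum>w\<in>V. (\<phi> i u * \<phi> j v) * (\<phi> i w * \<phi> j w))"
      by (subst sum.swap, intro sum.cong refl sum.swap)
    also have "\<dots> = (\<Sum>i<card V. \<Sum>j<card V. (\<phi> i u * \<phi> j v) * of_bool (i = j))"
      by (simp add: orth flip: sum_distrib_left)
    also have "\<dots> = P u v"
      by (simp add: P_def of_bool_def sum.delta if_distrib cong: if_cong)
    finally show ?thesis .
  qed
  have pick: "(\<Sum>w\<in>V. of_bool (u = w) * f w) = f u" if "u \<in> V" for u and f :: "'a \<Rightarrow> real"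
    using that fin by (simp add: of_bool_def if_distrib[of "\<lambda>x. x * _"] cong: if_cong)
  have residual: "(\<Sum>w\<in>V. (of_bool (u = w) - P u w)\<^sup>2) = 1 - P u u" if "u \<in> V" for u
  proof -
    have "(\<Sum>w\<in>V. (of_bool (u = w) - P u w)\<^sup>2)
        = (\<Sum>w\<in>V. of_bool (u = w) - 2 * (of_bool (u = w) * P u w) + P u w * P u w)"
      by (intro sum.cong) (auto simp: power2_eq_square algebra_simps)
    also have "\<dots> = 1 - 2 * P u u + P u u"
      using pick[OF that, of "\<lambda>_. 1"] pick[OF that, of "P u"]
      by (simp add: sum.distrib sum_subtractf proj flip: sum_distrib_left)
    finally show ?thesis by simp
  qed
  \<comment> \<open>Each \<open>P u u\<close> is at most 1 by Bessel's inequality, and the trace of \<open>P\<close> is \<open>card V\<close>.\<close>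
  have "(\<Sum>u\<in>V. P u u) = (\<Sum>j<card V. \<Sum>u\<in>V. \<phi> j u * \<phi> j u)"
    unfolding P_def by (rule sum.swap)
  also have "\<dots> = card V"
    by (simp add: orth)
  finally have "(\<Sum>u\<in>V. \<Sum>w\<in>V. (of_bool (u = w) - P u w)\<^sup>2) = 0"
    by (simp add: residual sum_subtractf)
  then have "(of_bool (u = v) - P u v)\<^sup>2 = 0"
    using fin uv by (simp add: sum_nonneg_eq_0_iff sum_nonneg)
  then show ?thesis
    by (simp add: P_def)
qed

text \<open>Spectral decomposition of the powers of the adjacency matrix: completeness of the basis
  gives length 0, and each further step brings in a factor \<open>lam j\<close> by the eigenvector
  equation.\<close>

lemma nwalks_spectral:
  assumes G: "finite (pverts G)" and \<phi>: "orthonormal_eigenbasis G \<phi> lam"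
    and "u \<in> pverts G" "v \<in> pverts G"
  shows "of_int (nwalks (pverts G) (\<lambda>x y. (x, y) \<in> parcs G) m u v)
    = (\<Sum>j<card (pverts G). lam j ^ m * (\<phi> j u * \<phi> j v))"
  using assms(4)
proof (induction m arbitrary: v)
  case 0
  have "of_bool (u = v) = (\<Sum>j<card (pverts G). \<phi> j u * \<phi> j v)"
    using \<phi> by (intro orthonormal_complete[symmetric] G assms(3) 0)
      (simp add: orthonormal_eigenbasis_def of_bool_def)
  then show ?case
    by simp
next
  case (Suc m)
  let ?n = "card (pverts G)"
  have "of_int (nwalks (pverts G) (\<lambda>x y. (x, y) \<in> parcs G) (Suc m) u v)
      = (\<Sum>w | w \<in> pverts G \<and> (v, w) \<in> parcs G. \<Sum>j<?n. lam j ^ m * (\<phi> j u * \<phi> j w))"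
    by (simp add: Suc.IH)
  also have "\<dots> = (\<Sum>w\<in>pverts G. adj_matrix G v w * (\<Sum>j<?n. lam j ^ m * (\<phi> j u * \<phi> j w)))"
    using G by (simp add: sum.inter_filter adj_matrix_def if_distrib[of "\<lambda>x. x * _"] cong: if_cong)
  also have "\<dots> = (\<Sum>w\<in>pverts G. \<Sum>j<?n. lam j ^ m * \<phi> j u * (adj_matrix G v w * \<phi> j w))"
    by (simp add: sum_distrib_left mult_ac)
  also have "\<dots> = (\<Sum>j<?n. lam j ^ m * \<phi> j u * (\<Sum>w\<in>pverts G. adj_matrix G v w * \<phi> j w))"
    by (subst sum.swap) (simp add: sum_distrib_left)
  also have "\<dots> = (\<Sum>j<?n. lam j ^ Suc m * (\<phi> j u * \<phi> j v))"
    using \<phi> Suc.prems by (simp add: orthonormal_eigenbasis_def mult_ac)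
  finally show ?case .
qed

text \<open>Grouped by eigenvalue, the spectral sum for closed walks involves the vertex only
  through the sums that cospectrality equates.\<close>

lemma cospectral_nwalks:
  assumes G: "finite (pverts G)" and ab: "a \<in> pverts G" "b \<in> pverts G"
    and "cospectral_vertices G a b"
  shows "nwalks (pverts G) (\<lambda>x y. (x, y) \<in> parcs G) m a a
    = nwalks (pverts G) (\<lambda>x y. (x, y) \<in> parcs G) m b b"
proof -
  let ?n = "card (pverts G)"
  obtain \<phi> lam where \<phi>: "orthonormal_eigenbasis G \<phi> lam"
    and eq: "\<And>\<mu>. \<mu> \<in> lam ` {..<?n} \<Longrightarrow>
      (\<Sum>j | j < ?n \<and> lam j = \<mu>. \<bar>\<phi> j a\<bar>\<^sup>2) = (\<Sum>j | j < ?n \<and> lam j = \<mu>. \<bar>\<phi> j b\<bar>\<^sup>2)"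
    using assms(4) by (auto simp: cospectral_vertices_def)
  have "of_int (nwalks (pverts G) (\<lambda>x y. (x, y) \<in> parcs G) m c c)
      = (\<Sum>\<mu>\<in>lam ` {..<?n}. \<mu> ^ m * (\<Sum>j | j < ?n \<and> lam j = \<mu>. \<bar>\<phi> j c\<bar>\<^sup>2))"
    if "c \<in> pverts G" for c
  proof -
    have "of_int (nwalks (pverts G) (\<lambda>x y. (x, y) \<in> parcs G) m c c)
        = (\<Sum>j<?n. lam j ^ m * \<bar>\<phi> j c\<bar>\<^sup>2)"
      by (simp add: nwalks_spectral[OF G \<phi> that that] power2_eq_square)
    also have "\<dots> = (\<Sum>\<mu>\<in>lam ` {..<?n}. \<Sum>j | j \<in> {..<?n} \<and> lam j = \<mu>. lam j ^ m * \<bar>\<phi> j c\<bar>\<^sup>2)"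
      by (rule sum.image_gen) simp
    also have "\<dots> = (\<Sum>\<mu>\<in>lam ` {..<?n}. \<mu> ^ m * (\<Sum>j | j < ?n \<and> lam j = \<mu>. \<bar>\<phi> j c\<bar>\<^sup>2))"
      by (intro sum.cong refl) (simp add: sum_distrib_left)
    finally show ?thesis .
  qed
  then have "real_of_int (nwalks (pverts G) (\<lambda>x y. (x, y) \<in> parcs G) m a a)
      = real_of_int (nwalks (pverts G) (\<lambda>x y. (x, y) \<in> parcs G) m b b)"
    using ab eq by simp
  then show ?thesis
    by simp
qed

section \<open>Enumeration of rooted regular graphs\<close>

text \<open>Empty cells are dropped so that the head cell always supplies a next vertex.\<close>

fun add_cell :: "nat \<times> nat \<Rightarrow> (nat \<times> nat) list \<Rightarrow> (nat \<times> nat) list" where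
  "add_cell (0, r) cs = cs"
| "add_cell (Suc m, r) cs = (Suc m, r) # cs"

text \<open>
  A cell \<open>(m, r)\<close> stands for \<open>m\<close> vertices that are not yet processed, that have the same neighbours
  among the processed vertices, and that each still need \<open>r\<close> neighbours. Relabelling inside cells
  puts the neighbours of the next vertex first in every cell, so only their number \<open>p\<close> matters.
\<close>

fun splits :: "(nat \<times> nat) list \<Rightarrow> nat \<Rightarrow> (bool list \<times> (nat \<times> nat) list) list" where
  "splits [] d = (if d = 0 then [([], [])] else [])"
| "splits ((m, r) # cs) d =
     concat (map (\<lambda>p. map (\<lambda>(row, ns). (replicate p True @ replicate (m - p) False @ row,
                            add_cell (p, r - 1) (add_cell (m - p, r) ns)))
                        (splits cs (d - p)))
               [0..<Suc (if r = 0 then 0 else min m d)])"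

text \<open>The next vertex is taken from the head cell. A branch is cut when some vertex needs more
  neighbours than the \<open>n\<close> other unprocessed vertices can provide. Isomorphic graphs may
  recur, which does no harm.\<close>

fun codes :: "nat \<Rightarrow> (nat \<times> nat) list \<Rightarrow> bool list list list" where
  "codes 0 cs = [[]]"
| "codes (Suc n) [] = []"
| "codes (Suc n) ((m, r) # cs) =
     (if list_ex (\<lambda>(_, s). n < s) ((m, r) # cs) then []
      else concat (map (\<lambda>(row, ns). map ((#) row) (codes n ns)) (splits (add_cell (m - 1, r) cs) r)))"

text \<open>The strict upper triangle of the adjacency matrix in the given order. For a simple graph
  it determines the whole matrix, which \<open>mat_of\<close> restores.\<close>

fun code_of :: "('a \<Rightarrow> 'a \<Rightarrow> bool) \<Rightarrow> 'a list \<Rightarrow> bool list list" where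
  "code_of E [] = []"
| "code_of E (x # xs) = map (E x) xs # code_of E xs"

fun mat_of :: "bool list list \<Rightarrow> bool list list" where
  "mat_of [] = []"
| "mat_of (row # rows) = (False # row) # map2 (#) row (mat_of rows)"

lemma mat_of_code_of:
  assumes "\<And>u v. E u v \<longleftrightarrow> E v u" and "\<And>u. \<not> E u u"
  shows "mat_of (code_of E vs) = map (\<lambda>u. map (E u) vs) vs"
proof (induction vs)
  case (Cons x xs)
  have "map2 (#) (map (E x) xs) (map (\<lambda>u. map (E u) xs) xs) = map (\<lambda>u. E u x # map (E u) xs) xs"
    by (subst assms(1)) (simp add: zip_map_map zip_same_conv_map)
  with Cons assms(2) show ?case by simp
qed simp

text \<open>Cells keep their places while the vertices inside each are permuted freely: these are
  the relabellings among which the enumeration may choose.\<close>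

fun arranges :: "('a list \<times> 'b) list \<Rightarrow> 'a list \<Rightarrow> bool" where
  "arranges [] vs \<longleftrightarrow> vs = []"
| "arranges ((C, r) # Cs) vs \<longleftrightarrow> (\<exists>w vs'. vs = w @ vs' \<and> mset w = mset C \<and> arranges Cs vs')"

definition shape :: "('a list \<times> nat) list \<Rightarrow> (nat \<times> nat) list" where
  "shape Cs = map (\<lambda>(C, r). (length C, r)) Cs"

definition members :: "('a list \<times> nat) list \<Rightarrow> 'a list" where
  "members Cs = concat (map fst Cs)"

definition cons_cell :: "'a list \<Rightarrow> nat \<Rightarrow> ('a list \<times> nat) list \<Rightarrow> ('a list \<times> nat) list" where
  "cons_cell C r Cs = (if C = [] then Cs else (C, r) # Cs)"

text \<open>The counterpart of \<open>splits\<close> on actual vertices, with \<open>P\<close> as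
  adjacency to the processed vertex: its neighbours come first in each cell and need one neighbour
  fewer.\<close>

fun refine :: "('a \<Rightarrow> bool) \<Rightarrow> ('a list \<times> nat) list \<Rightarrow> ('a list \<times> nat) list" where
  "refine P [] = []"
| "refine P ((C, r) # Cs) =
     cons_cell (filter P C) (r - 1) (cons_cell (filter (\<lambda>y. \<not> P y) C) r (refine P Cs))"

lemma shape_simps [simp]:
  "shape [] = []" "shape ((C, r) # Cs) = (length C, r) # shape Cs"
  by (simp_all add: shape_def)

lemma members_simps [simp]:
  "members [] = []" "members ((C, r) # Cs) = C @ members Cs"
  by (simp_all add: members_def)

lemma shape_cons_cell [simp]: "shape (cons_cell C r Cs) = add_cell (length C, r) (shape Cs)"
  by (cases C) (simp_all add: cons_cell_def)

lemma members_cons_cell [simp]: "members (cons_cell C r Cs) = C @ members Cs"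
  by (simp add: cons_cell_def)

lemma arranges_cons_cell [simp]:
  "arranges (cons_cell C r Cs) vs \<longleftrightarrow> arranges ((C, r) # Cs) vs"
  by (simp add: cons_cell_def)

lemma set_cons_cell: "set (cons_cell C r Cs) = {p. p = (C, r) \<and> C \<noteq> []} \<union> set Cs"
  by (auto simp: cons_cell_def)

lemma mset_arranges: "arranges Cs vs \<Longrightarrow> mset vs = mset (members Cs)"
  by (induction Cs vs rule: arranges.induct) auto

lemma mset_members_refine: "mset (members (refine P Cs)) = mset (members Cs)"
  by (induction P Cs rule: refine.induct) (simp_all flip: add.assoc multiset_partition)

lemma set_refine:
  assumes "(B, s) \<in> set (refine P Cs)"
  shows "B \<noteq> [] \<and> (\<exists>C r. (C, r) \<in> set Cs \<and>
    (B = filter P C \<and> s = r - 1 \<or> B = filter (\<lambda>y. \<not> P y) C \<and> s = r))"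
  using assms by (induction P Cs rule: refine.induct) (auto simp: set_cons_cell)

lemma map_eq_replicate: "(\<And>x. x \<in> set xs \<Longrightarrow> f x = c) \<Longrightarrow> map f xs = replicate (length xs) c"
  by (induction xs) auto

text \<open>An order that respects the refined cells lists the neighbours first in every old cell,
  so the row is a block pattern that \<open>splits\<close> offers, with \<open>p\<close> the number
  of neighbours in the cell.\<close>

lemma splits_refine:
  assumes "arranges (refine P Cs) vs"
    and "\<And>C. (C, 0) \<in> set Cs \<Longrightarrow> filter P C = []"
    and "length (filter P (members Cs)) = d"
  shows "(map P vs, shape (refine P Cs)) \<in> set (splits (shape Cs) d) \<and> arranges Cs vs"
  using assms
proof (induction P Cs arbitrary: vs d rule: refine.induct)
  case (2 P C r Cs)
  from "2.prems"(1) obtain w1 w2 vs' where vs: "vs = w1 @ w2 @ vs'"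
    and w1: "mset w1 = mset (filter P C)" and w2: "mset w2 = mset (filter (\<lambda>y. \<not> P y) C)"
    and vs': "arranges (refine P Cs) vs'"
    by auto
  define p where "p = length (filter P C)"
  have IH: "(map P vs', shape (refine P Cs)) \<in> set (splits (shape Cs) (d - p))" "arranges Cs vs'"
    using "2.IH"[OF vs', of "d - p"] "2.prems"(2,3) by (auto simp: p_def)
  have len: "length w1 = p" "length w2 = length C - p"
    using w1 w2 sum_length_filter_compl[of P C] by (metis p_def size_mset add_diff_cancel_left')+
  have "map P w1 = replicate (length w1) True" "map P w2 = replicate (length w2) False"
    using mset_eq_setD[OF w1] mset_eq_setD[OF w2] by (auto intro!: map_eq_replicate)
  then have row: "map P vs = replicate p True @ replicate (length C - p) False @ map P vs'"
    by (simp add: vs len)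
  have "p \<in> set [0..<Suc (if r = 0 then 0 else min (length C) d)]"
  proof -
    have "p \<le> length C" "p \<le> d" "r = 0 \<Longrightarrow> p = 0"
      using "2.prems"(2)[of C] "2.prems"(3) by (auto simp: p_def)
    then show ?thesis by auto
  qed
  moreover have "length (filter (\<lambda>y. \<not> P y) C) = length C - p"
    using sum_length_filter_compl[of P C] by (simp add: p_def)
  ultimately have "(map P vs, shape (refine P ((C, r) # Cs))) \<in> set (splits (shape ((C, r) # Cs)) d)"
    using IH(1) by (force simp: row p_def[symmetric])
  moreover have "mset (w1 @ w2) = mset C"
    by (simp add: w1 w2 flip: multiset_partition)
  ultimately show ?case
    using IH(2) vs by (metis append.assoc arranges.simps(2))
qed auto

text \<open>Induction on the number of unprocessed vertices. The head \<open>x\<close> is removed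
  and the remaining cells are refined by adjacency to \<open>x\<close>; this keeps the invariant
  that the label of a cell is the degree of its members among the unprocessed vertices. The order
  from the induction hypothesis is then preceded by \<open>x\<close>.\<close>

lemma codes_complete:
  assumes sym: "\<And>u v. E u v \<longleftrightarrow> E v u" and irrefl: "\<And>u. \<not> E u u"
    and "length (members Cs) = n"
    and "\<And>C r. (C, r) \<in> set Cs \<Longrightarrow> C \<noteq> []"
    and "\<And>C r y. (C, r) \<in> set Cs \<Longrightarrow> y \<in> set C \<Longrightarrow> length (filter (E y) (members Cs)) = r"
  shows "\<exists>vs. arranges Cs vs \<and> code_of E vs \<in> set (codes n (shape Cs))"
  using assms(3-)
proof (induction n arbitrary: Cs)
  case 0
  then have "Cs = []"
    by (cases Cs) (fastforce simp: members_def)+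
  then show ?case by simp
next
  case (Suc n)
  obtain x C r Cs' where Cs: "Cs = (x # C, r) # Cs'"
    using Suc.prems(1,2)
    by (metis members_simps(1) list.size(3) nat.distinct(1) neq_Nil_conv surj_pair list.set_intros(1))
  define D where "D = cons_cell C r Cs'"
  define R where "R = refine (E x) D"
  have members: "members Cs = x # members D"
    by (simp add: Cs D_def)
  have D: "\<exists>B. (B, s) \<in> set Cs \<and> set A \<subseteq> set B" if "(A, s) \<in> set D" for A s
    using that by (auto simp: D_def Cs set_cons_cell)
  \<comment> \<open>Removing \<open>x\<close> costs a vertex one unit of degree exactly if it is
    adjacent to \<open>x\<close>; this is the decrement in \<open>refine\<close>.\<close>
  have degD: "of_bool (E y x) + length (filter (E y) (members D)) = s"
    if "(A, s) \<in> set D" "y \<in> set A" for A s y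
    using D[OF that(1)] that(2) Suc.prems(3)[of _ s y] by (auto simp: members split: if_splits)
  have filter_members: "length (filter (E y) (members R)) = length (filter (E y) (members D))" for y
    unfolding R_def by (metis mset_members_refine mset_filter size_mset)
  have "\<exists>vs. arranges R vs \<and> code_of E vs \<in> set (codes n (shape R))"
  proof (rule Suc.IH)
    show "length (members R) = n"
      using Suc.prems(1) members by (metis R_def mset_members_refine size_mset length_Cons nat.inject)
    show "B \<noteq> []" if "(B, s) \<in> set R" for B s
      using set_refine that unfolding R_def by blast
    show "length (filter (E y) (members R)) = s" if Bs: "(B, s) \<in> set R" and y: "y \<in> set B" for B s y
    proof -
      obtain A t where A: "(A, t) \<in> set D"
        "B = filter (E x) A \<and> s = t - 1 \<or> B = filter (\<lambda>y. \<not> E x y) A \<and> s = t"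
        using set_refine Bs unfolding R_def by blast
      then have "y \<in> set A"
        using y by auto
      from degD[OF A(1) this] A(2) y sym[of y x] show ?thesis
        by (auto simp: filter_members)
    qed
  qed
  then obtain vs where vs: "arranges R vs" "code_of E vs \<in> set (codes n (shape R))"
    by blast
  \<comment> \<open>A vertex adjacent to \<open>x\<close> still needs at least one neighbour, so
    cells labelled 0 contain none.\<close>
  have "filter (E x) A = []" if "(A, 0) \<in> set D" for A
    using degD[OF that] sym by (fastforce simp: filter_empty_conv)
  moreover have "length (filter (E x) (members D)) = r"
    using Suc.prems(3)[of "x # C" r x] irrefl by (simp add: Cs D_def)
  ultimately have *: "(map (E x) vs, shape R) \<in> set (splits (shape D) r)" "arranges D vs"
    using splits_refine[OF vs(1)[unfolded R_def]] by (auto simp: R_def)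
  \<comment> \<open>The pruning test of \<open>codes\<close> lets this branch pass, because a vertex
    is not its own neighbour.\<close>
  have "\<not> n < s" if Bs: "(B, s) \<in> set Cs" for B s
  proof -
    obtain y where y: "y \<in> set B"
      using Suc.prems(2)[OF Bs] by (cases B) auto
    then have "y \<in> set (members Cs)"
      using Bs by (force simp: members_def)
    then have "length (filter (E y) (members Cs)) < length (members Cs)"
      using irrefl by (rule length_filter_less)
    with Suc.prems(1) Suc.prems(3)[OF Bs y] show ?thesis by simp
  qed
  then have "\<not> list_ex (\<lambda>(_, s). n < s) (shape Cs)"
    by (auto simp: shape_def list_ex_iff)
  then have "code_of E (x # vs) \<in> set (codes (Suc n) (shape Cs))"
    using *(1) vs(2) by (force simp: Cs D_def)
  moreover have "arranges Cs (x # vs)"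
    using *(2) by (auto simp: Cs D_def) (metis append_Cons mset.simps(2))
  ultimately show ?case by blast
qed

text \<open>The root has a cell of its own at the head, so it is processed first; all other vertices
  start out indistinguishable.\<close>

definition regular_codes :: "nat \<Rightarrow> nat \<Rightarrow> bool list list list" where
  "regular_codes n k = codes n (add_cell (1, k) (add_cell (n - 1, k) []))"

lemma regular_codes_complete:
  assumes sym: "\<And>u v. E u v \<longleftrightarrow> E v u" and irrefl: "\<And>u. \<not> E u u"
    and V: "finite V" "a \<in> V" and regular: "\<And>u. u \<in> V \<Longrightarrow> card {v \<in> V. E u v} = k"
  shows "\<exists>vs. set (a # vs) = V \<and> distinct (a # vs) \<and>
    code_of E (a # vs) \<in> set (regular_codes (card V) k)"
proof -
  obtain xs where xs: "set xs = V - {a}" "distinct xs"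
    using finite_distinct_list V(1) by (metis finite_Diff)
  define Cs where "Cs = cons_cell [a] k (cons_cell xs k [])"
  have set: "set (a # xs) = V" and dist: "distinct (a # xs)"
    using xs V(2) by auto
  then have card: "card V = Suc (length xs)"
    using distinct_card by (metis length_Cons)
  have members: "members Cs = a # xs"
    by (simp add: Cs_def)
  have deg: "length (filter (E y) (a # xs)) = k" if "y \<in> V" for y
    using regular[OF that] dist set
    by (metis distinct_card distinct_filter set_filter)
  obtain vs where vs: "arranges Cs vs" "code_of E vs \<in> set (codes (card V) (shape Cs))"
    using codes_complete[OF sym irrefl, where Cs = Cs and n = "card V"] deg set members card
    by (force simp: Cs_def set_cons_cell)
  then obtain ws where "vs = a # ws"
    by (auto simp: Cs_def)
  moreover have mset: "mset vs = mset (a # xs)"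
    using mset_arranges[OF vs(1)] members by simp
  then have "set vs = V" "distinct vs"
    using mset_eq_setD[OF mset] set mset_eq_imp_distinct_iff[OF mset] dist by simp_all
  moreover have "shape Cs = add_cell (1, k) (add_cell (card V - 1, k) [])"
    by (simp add: Cs_def card)
  ultimately show ?thesis
    using vs(2) by (auto simp: regular_codes_def)
qed

section \<open>Regular graphs on at most nine vertices\<close>

fun bool_dot :: "bool list \<Rightarrow> int list \<Rightarrow> int" where
  "bool_dot (b # bs) (x # xs) = (if b then x + bool_dot bs xs else bool_dot bs xs)"
| "bool_dot _ _ = 0"

text \<open>
  In a call, \<open>r\<close> and \<open>s\<close> are the rows of two vertices in the matrix \<open>M\<close>, and the entries of \<open>x\<close> and
  \<open>y\<close> count the walks of some fixed length from these vertices.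
\<close>

fun walks_differ :: "nat \<Rightarrow> bool list list \<Rightarrow> bool list \<Rightarrow> int list \<Rightarrow> bool list \<Rightarrow> int list \<Rightarrow> bool" where
  "walks_differ 0 M r x s y = False"
| "walks_differ (Suc n) M r x s y = (bool_dot r x \<noteq> bool_dot s y \<or>
     walks_differ n M r (map (\<lambda>t. bool_dot t x) M) s (map (\<lambda>t. bool_dot t y) M))"

text \<open>\<open>r\<close> is compared only as far as \<open>vs\<close> reaches; its later entries
  are left to later rows, by symmetry.\<close>

fun agrees :: "bool list \<Rightarrow> nat list \<Rightarrow> bool list \<Rightarrow> bool" where
  "agrees r [] t = True"
| "agrees [] (v # vs) t = False"
| "agrees (b # r) (v # vs) t = (b = t ! v \<and> agrees r vs t)"

text \<open>
  The first rows of the matrix \<open>M\<close> are already mapped to the indices in \<open>fs\<close>; the rows in the second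
  argument remain to be mapped.
\<close>

fun extendable :: "bool list list \<Rightarrow> bool list list \<Rightarrow> nat list \<Rightarrow> bool" where
  "extendable M [] fs = True"
| "extendable M (r # rs) fs = list_ex (\<lambda>(w, t). w \<notin> set fs \<and> agrees r fs t \<and> extendable M rs (fs @ [w])) (List.enumerate 0 M)"

text \<open>
  Six rounds starting from the walks of length 1 compare the closed walks of length 2 to 7. Length 6
  would not suffice for some quartic graphs on 9 vertices.
\<close>

definition root_determined :: "bool list list \<Rightarrow> bool" where
  "root_determined c = (case mat_of c of [] \<Rightarrow> False | r # M \<Rightarrow>
      list_all (\<lambda>(b, s). walks_differ 6 (r # M) r (map of_bool r) s (map of_bool s) \<or> extendable (r # M) M [b])
        (List.enumerate 1 M))"

section \<open>Soundness of the tests\<close>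

lemma bool_dot_map:
  assumes "distinct vs"
  shows "bool_dot (map P vs) (map f vs) = (\<Sum>w | w \<in> set vs \<and> P w. f w)"
  using assms
proof (induction vs)
  case (Cons v vs)
  have "{w \<in> set (v # vs). P w} = (if P v then insert v {w \<in> set vs. P w} else {w \<in> set vs. P w})"
    by auto
  with Cons show ?case by simp
qed simp

text \<open>Invariant: the vectors in a call count the walks of length \<open>m\<close> from
  \<open>a\<close> and from \<open>b\<close>; the row of a vertex times its vector counts the closed
  walks of length \<open>Suc m\<close>.\<close>

lemma walks_differ_sound:
  assumes "walks_differ n (map (\<lambda>u. map (E u) vs) vs) (map (E a) vs) (map (nwalks (set vs) E m a) vs)
             (map (E b) vs) (map (nwalks (set vs) E m b) vs)"
    and "distinct vs"
  shows "\<exists>m. nwalks (set vs) E m a a \<noteq> nwalks (set vs) E m b b"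
  using assms
proof (induction n arbitrary: m)
  case (Suc n)
  have step: "(\<lambda>u. bool_dot (map (E u) vs) (map (nwalks (set vs) E m c) vs)) = nwalks (set vs) E (Suc m) c" for c
    using Suc.prems(2) by (simp add: fun_eq_iff bool_dot_map)
  show ?case
  proof (cases "nwalks (set vs) E (Suc m) a a = nwalks (set vs) E (Suc m) b b")
    case True
    then have "walks_differ n (map (\<lambda>u. map (E u) vs) vs) (map (E a) vs) (map (nwalks (set vs) E (Suc m) a) vs)
        (map (E b) vs) (map (nwalks (set vs) E (Suc m) b) vs)"
      using Suc.prems(1) unfolding step[symmetric] by (simp add: o_def)
    from Suc.IH[OF this Suc.prems(2)] show ?thesis .
  qed blast
qed simp

lemma agrees_nth: "agrees r vs t \<Longrightarrow> j < length vs \<Longrightarrow> r ! j = t ! (vs ! j)"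
  by (induction r vs t arbitrary: j rule: agrees.induct) (auto simp: nth_Cons split: nat.split)

text \<open>The choices of the search form \<open>gs\<close>. Entries with
  \<open>j < length fs + i\<close> lie left of the diagonal, since the rows in \<open>rs\<close>
  follow those already mapped to \<open>fs\<close>.\<close>

lemma extendable_sound:
  assumes "extendable M rs fs" "distinct fs" "set fs \<subseteq> {..<length M}"
  shows "\<exists>gs. length gs = length rs \<and> distinct (fs @ gs) \<and> set gs \<subseteq> {..<length M} \<and>
    (\<forall>i<length rs. \<forall>j<length fs + i. rs ! i ! j = M ! (gs ! i) ! ((fs @ gs) ! j))"
  using assms
proof (induction rs arbitrary: fs)
  case (Cons r rs)
  obtain w where w: "w < length M" "w \<notin> set fs" "agrees r fs (M ! w)" "extendable M rs (fs @ [w])"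
    using Cons.prems(1) by (auto simp: list_ex_iff in_set_enumerate_eq)
  obtain gs where gs: "length gs = length rs" "distinct ((fs @ [w]) @ gs)" "set gs \<subseteq> {..<length M}"
    "\<forall>i<length rs. \<forall>j<length (fs @ [w]) + i. rs ! i ! j = M ! (gs ! i) ! (((fs @ [w]) @ gs) ! j)"
    using Cons.IH[OF w(4)] w(1,2) Cons.prems(2,3) by auto
  have "(r # rs) ! i ! j = M ! ((w # gs) ! i) ! ((fs @ w # gs) ! j)"
    if "i < length (r # rs)" "j < length fs + i" for i j
    using that gs(4) agrees_nth[OF w(3)] by (cases i) (auto simp: nth_append)
  with gs w(1) show ?case
    by (intro exI[of _ "w # gs"]) auto
qed simp


text \<open>Equal closed walk counts rule out \<open>walks_differ\<close>, so the search has
  succeeded. Its choices form a permutation of the indices that preserves adjacency below the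
  diagonal, hence everywhere by symmetry and irreflexivity.\<close>

lemma root_determined_sound:
  assumes sym: "\<And>u v. E u v \<longleftrightarrow> E v u" and irrefl: "\<And>u. \<not> E u u"
    and dist: "distinct vs" and vs: "vs = a # vs'" and b: "b \<in> set vs"
    and rd: "root_determined (code_of E vs)"
    and walks: "\<And>m. nwalks (set vs) E m a a = nwalks (set vs) E m b b"
  shows "\<exists>f. bij_betw f (set vs) (set vs) \<and> (\<forall>u\<in>set vs. \<forall>v\<in>set vs. E (f u) (f v) \<longleftrightarrow> E u v) \<and> f a = b"
proof (cases "a = b")
  case True
  then show ?thesis
    by (intro exI[of _ id]) auto
next
  case False
  define n where "n = length vs"
  define M where "M = map (\<lambda>u. map (E u) vs) vs"
  have nth_M: "M ! i ! j \<longleftrightarrow> E (vs ! i) (vs ! j)" if "i < n" "j < n" for i j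
    using that by (simp add: M_def n_def)
  define rows where "rows = map (\<lambda>u. map (E u) vs) vs'"
  have M: "M = map (E a) vs # rows"
    by (simp add: M_def rows_def vs)
  obtain i where i: "i < length vs'" "vs' ! i = b"
    using b False by (auto simp: vs in_set_conv_nth)
  \<comment> \<open>A row of the matrix, read as numbers, is the vector of walks of length 1, from
    which the iteration starts.\<close>
  have row: "map of_bool (map (E c) vs) = map (nwalks (set vs) E 1 c) vs" if "c \<in> set vs" for c
  proof -
    have "nwalks (set vs) E 1 c v = of_bool (E v c)" for v
      using that by (simp add: of_bool_def)
    then have "nwalks (set vs) E 1 c = (\<lambda>v. of_bool (E c v))"
      by (subst sym) (rule ext)
    then show ?thesis by (simp only: map_map o_def)
  qed
  have "mat_of (code_of E vs) = map (E a) vs # rows"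
    unfolding M[symmetric] M_def by (rule mat_of_code_of[OF sym irrefl])
  then have "list_all (\<lambda>(c, s). walks_differ 6 M (map (E a) vs) (map of_bool (map (E a) vs)) s
      (map of_bool s) \<or> extendable M rows [c]) (List.enumerate 1 rows)"
    using rd by (simp only: root_determined_def M list.case)
  moreover have "(Suc i, map (E b) vs) \<in> set (List.enumerate 1 rows)"
    using i by (auto simp: in_set_enumerate_eq rows_def)
  ultimately have "walks_differ 6 M (map (E a) vs) (map of_bool (map (E a) vs))
      (map (E b) vs) (map of_bool (map (E b) vs)) \<or> extendable M rows [Suc i]"
    by (auto simp only: list_all_iff)
  moreover have a: "a \<in> set vs"
    by (simp add: vs)
  then have "\<not> walks_differ 6 M (map (E a) vs) (map of_bool (map (E a) vs))
      (map (E b) vs) (map of_bool (map (E b) vs))"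
    unfolding row[OF b] row[OF a]
    using walks_differ_sound[OF _ dist, of 6 E a 1 b, folded M_def] walks by blast
  ultimately have "extendable M (rows) [Suc i]"
    by blast
  then obtain gs where gs: "length gs = length vs'" "distinct (Suc i # gs)" "set gs \<subseteq> {..<n}"
    "\<And>k j. k < length vs' \<Longrightarrow> j < Suc k \<Longrightarrow> rows ! k ! j = M ! (gs ! k) ! ((Suc i # gs) ! j)"
    using extendable_sound[of M "rows" "[Suc i]"] i by (auto simp: M_def rows_def vs n_def)
  \<comment> \<open>Index 0 of \<open>vs\<close> is the root \<open>a\<close>; its image
    \<open>Suc i\<close> is the index of \<open>b\<close>, since \<open>i\<close> counts in
    \<open>vs'\<close>.\<close>
  define p where "p = Suc i # gs"
  have p: "length p = n" "distinct p" "set p \<subseteq> {..<n}"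
    using gs(1-3) i by (auto simp: p_def n_def vs)
  have p_less: "p ! k < n" if "k < n" for k
    using that p nth_mem by (metis lessThan_iff subsetD)
  have E_less: "E (vs ! (p ! k)) (vs ! (p ! j)) \<longleftrightarrow> E (vs ! k) (vs ! j)" if kj: "k < n" "j < k" for k j
  proof -
    obtain k' where k: "k = Suc k'"
      using kj by (cases k) auto
    then have "M ! k ! j = M ! (p ! k) ! (p ! j)"
      using gs(4)[of k' j] kj M by (metis n_def vs p_def nth_Cons_Suc length_Cons Suc_less_eq)
    then show ?thesis
      using nth_M p_less kj by (meson order.strict_trans)
  qed
  have E_p: "E (vs ! (p ! k)) (vs ! (p ! j)) \<longleftrightarrow> E (vs ! k) (vs ! j)" if "k < n" "j < n" for k j
    using that E_less sym irrefl by (metis linorder_neqE_nat)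
  \<comment> \<open>The index permutation \<open>p\<close> becomes a map on vertices by table
    lookup.\<close>
  define f where "f = (\<lambda>v. the (map_of (zip vs (map ((!) vs) p)) v))"
  have f: "f (vs ! k) = vs ! (p ! k)" if "k < n" for k
    using map_of_zip_nth[OF _ dist, of "map ((!) vs) p" k] p(1) that by (simp add: f_def n_def)
  have "inj_on f (set vs)"
    using f p dist by (auto simp: inj_on_def in_set_conv_nth n_def nth_eq_iff_index_eq p_less[unfolded n_def])
  moreover have "f v \<in> set vs" if v: "v \<in> set vs" for v
  proof -
    obtain k where "k < n" "v = vs ! k"
      using v by (auto simp: in_set_conv_nth n_def)
    then show ?thesis
      using f p_less by (simp add: n_def)
  qed
  then have "f ` set vs \<subseteq> set vs"
    by blast
  ultimately have "bij_betw f (set vs) (set vs)"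
    by (simp add: bij_betw_def endo_inj_surj)
  moreover have "E (f u) (f v) \<longleftrightarrow> E u v" if "u \<in> set vs" "v \<in> set vs" for u v
    using that f E_p by (auto simp: in_set_conv_nth n_def)
  moreover have "f a = b"
    using f[of 0] i by (simp add: n_def vs p_def)
  ultimately show ?thesis by blast
qed

text \<open>Exhaustive check by evaluation. Degrees below \<open>n\<close> are all that a simple
  graph on \<open>n\<close> vertices can have.\<close>

lemma root_determined_upto_8:
  "list_all (\<lambda>n. list_all (\<lambda>k. list_all root_determined (regular_codes n k)) [0..<n]) [1..<9]"
  by code_simp

lemma root_determined_9: "list_all (\<lambda>k. list_all root_determined (regular_codes 9 k)) [0..<9]"
  by code_simp

lemma root_determined_regular_codes:
  assumes "0 < n" "n < 10" "k < n" "c \<in> set (regular_codes n k)"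
  shows "root_determined c"
proof -
  have k: "k \<in> set [0..<n]" and "n = 9 \<or> n \<in> set [1..<9]"
    using assms(1-3) by auto
  then have "list_all (\<lambda>k. list_all root_determined (regular_codes n k)) [0..<n]"
    using root_determined_upto_8 root_determined_9 by (metis (no_types, lifting) list.pred_set)
  then show ?thesis
    using k assms(4) by (simp only: list_all_iff)
qed

lemma card_out_neighbours:
  assumes "pair_graph G"
  shows "card {v \<in> pverts G. (u, v) \<in> parcs G} = out_degree (with_proj G) u"
proof -
  interpret pair_graph G by fact
  have "bij_betw snd (out_arcs (with_proj G) u) {v \<in> pverts G. (u, v) \<in> parcs G}"
    by (auto simp: bij_betw_def inj_on_def out_arcs_def image_iff dest: in_arcsD2)
  then show ?thesis
    by (simp add: out_degree_def bij_betw_same_card)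
qed

lemma cospectral_imp_similar:
  assumes graph: "pair_graph G" and regular: "regular_graph G" and card: "card (pverts G) < 10"
    and ab: "a \<in> pverts G" "b \<in> pverts G" and cospectral: "cospectral_vertices G a b"
  shows "similar_vertices G a b"
proof -
  interpret pair_graph G by fact
  define E where "E = (\<lambda>x y. (x, y) \<in> parcs G)"
  have sym: "E u v \<longleftrightarrow> E v u" for u v
    using pair_sym_arcs by (auto simp: E_def symmetric_def dest: symD)
  have irrefl: "\<not> E u u" for u
    using pair_no_loops[of "(u, u)"] by (auto simp: E_def)
  note fin = pair_finite_verts
  obtain k where k: "\<And>u. u \<in> pverts G \<Longrightarrow> card {v \<in> pverts G. E u v} = k"
    using regular card_out_neighbours[OF graph] by (auto simp: regular_graph_def E_def)
  obtain vs' where vs: "set (a # vs') = pverts G" "distinct (a # vs')"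
    "code_of E (a # vs') \<in> set (regular_codes (card (pverts G)) k)"
    using regular_codes_complete[OF sym irrefl fin ab(1) k] by blast
  \<comment> \<open>Since \<open>a\<close> is not its own neighbour, the degree lies in the range
    that was checked.\<close>
  have "{v \<in> pverts G. E a v} \<subset> pverts G"
    using ab(1) irrefl by auto
  then have "k < card (pverts G)"
    using k[OF ab(1)] fin by (metis psubset_card_mono)
  then have "root_determined (code_of E (a # vs'))"
    using root_determined_regular_codes[OF _ card _ vs(3)] by simp
  then obtain f where "bij_betw f (pverts G) (pverts G)" "f a = b"
    "\<And>u v. u \<in> pverts G \<Longrightarrow> v \<in> pverts G \<Longrightarrow> E (f u) (f v) \<longleftrightarrow> E u v"
    using root_determined_sound[where E = E and b = b, OF sym irrefl vs(2) refl] vs(1) ab(2)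
      cospectral_nwalks[OF fin ab cospectral] unfolding E_def by (metis (no_types, lifting))
  then show ?thesis
    by (auto simp: similar_vertices_def graph_automorphism_def E_def)
qed

section \<open>A cubic graph on ten vertices\<close>

text \<open>Normalising brings in square roots, but cospectrality sees only squares. So an
  orthogonal basis with integer entries can serve, each square being divided by the squared norm
  \<open>nrm\<close>.\<close>

lemma cospectral_verticesI:
  fixes \<psi> :: "nat \<Rightarrow> 'a \<Rightarrow> real"
  defines "nrm \<equiv> \<lambda>G j. \<Sum>v \<in> pverts G. (\<psi> j v)\<^sup>2"
  assumes orth: "\<And>i j. i < card (pverts G) \<Longrightarrow> j < card (pverts G) \<Longrightarrow> i \<noteq> j \<Longrightarrow>
      (\<Sum>v \<in> pverts G. \<psi> i v * \<psi> j v) = 0"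
    and pos: "\<And>j. j < card (pverts G) \<Longrightarrow> nrm G j > 0"
    and eigen: "\<And>j u. j < card (pverts G) \<Longrightarrow> u \<in> pverts G \<Longrightarrow>
      (\<Sum>v \<in> pverts G. adj_matrix G u v * \<psi> j v) = lam j * \<psi> j u"
    and eq: "\<And>\<mu>. \<mu> \<in> lam ` {..<card (pverts G)} \<Longrightarrow>
      (\<Sum>j | j < card (pverts G) \<and> lam j = \<mu>. (\<psi> j a)\<^sup>2 / nrm G j) =
      (\<Sum>j | j < card (pverts G) \<and> lam j = \<mu>. (\<psi> j b)\<^sup>2 / nrm G j)"
  shows "cospectral_vertices G a b"
proof -
  define \<phi> where "\<phi> = (\<lambda>j v. \<psi> j v / sqrt (nrm G j))"
  have sq: "(\<phi> j v)\<^sup>2 = (\<psi> j v)\<^sup>2 / nrm G j" if "j < card (pverts G)" for j v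
    using pos[OF that] by (simp add: \<phi>_def power_divide)
  have "(\<Sum>v \<in> pverts G. \<phi> i v * \<phi> j v) = (if i = j then 1 else 0)"
    if "i < card (pverts G)" "j < card (pverts G)" for i j
  proof -
    have "(\<Sum>v \<in> pverts G. \<phi> i v * \<phi> j v)
        = (\<Sum>v \<in> pverts G. \<psi> i v * \<psi> j v) / (sqrt (nrm G i) * sqrt (nrm G j))"
      by (simp add: \<phi>_def sum_divide_distrib)
    also have "\<dots> = (if i = j then 1 else 0)"
    proof (cases "i = j")
      case True
      then show ?thesis
        using pos[OF that(1)] by (simp add: nrm_def power2_eq_square)
    qed (simp add: orth[OF that])
    finally show ?thesis .
  qed
  moreover have "(\<Sum>v \<in> pverts G. adj_matrix G u v * \<phi> j v) = lam j * \<phi> j u"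
    if "j < card (pverts G)" "u \<in> pverts G" for j u
    using eigen[OF that] by (simp add: \<phi>_def flip: sum_divide_distrib)
  ultimately have "orthonormal_eigenbasis G \<phi> lam"
    by (simp add: orthonormal_eigenbasis_def)
  moreover have "(\<Sum>j | j < card (pverts G) \<and> lam j = \<mu>. \<bar>\<phi> j a\<bar>\<^sup>2) =
      (\<Sum>j | j < card (pverts G) \<and> lam j = \<mu>. \<bar>\<phi> j b\<bar>\<^sup>2)"
    if "\<mu> \<in> lam ` {..<card (pverts G)}" for \<mu>
    using eq[OF that] by (simp add: sq)
  ultimately show ?thesis
    unfolding cospectral_vertices_def by blast
qed

section \<open>The graph, its regularity and its connectedness\<close>

definition example_edges :: "(nat \<times> nat) list" where
  "example_edges = [(0, 1), (0, 2), (0, 3), (1, 4), (2, 5), (3, 6), (1, 7), (2, 8), (3, 9),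
     (4, 5), (4, 6), (5, 6), (7, 8), (7, 9), (8, 9)]"

definition example :: "nat pair_pre_digraph" where
  "example = \<lparr>pverts = {..<10}, parcs = set example_edges \<union> (set example_edges)\<inverse>\<rparr>"

lemma example_simps [simp]:
  "pverts example = {..<10}"
  "(u, v) \<in> parcs example \<longleftrightarrow> (u, v) \<in> set example_edges \<or> (v, u) \<in> set example_edges"
  by (simp_all add: example_def)

text \<open>Bounded quantifiers, and next also sums, become list functions that
  \<open>code_simp\<close> can evaluate.\<close>

lemma ball_lessThan_upt: "(\<forall>v\<in>{..<n}. P v) \<longleftrightarrow> list_all P [0..<n]"
  by (auto simp: list_all_iff)

lemma sum_lessThan_upt: "(\<Sum>v<n. f v) = (\<Sum>v\<leftarrow>[0..<n]. f v)"
  by (simp add: interv_sum_list_conv_sum_set_nat atLeast0LessThan)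

lemma upt_10: "[0..<10] = [0, 1, 2, 3, 4, 5, 6, 7, 8, 9]"
  by (simp add: upt_conv_Cons)

lemma pair_graph_example: "pair_graph example"
proof
  have "(v, u) \<in> parcs example" if "(u, v) \<in> parcs example" for u v
    using that by auto
  then show "symmetric (with_proj example)"
    by (auto simp: symmetric_def intro: symI)
qed (auto simp: example_edges_def example_def)

lemma regular_example: "regular_graph example"
proof -
  have "out_degree (with_proj example) v = 3" if "v \<in> {..<10}" for v
  proof -
    have "out_arcs (with_proj example) v = Pair v ` {w \<in> {..<10}. (v, w) \<in> parcs example}"
      using pair_wf_digraph.in_arcsD2[of example] pair_graph_example
      unfolding out_arcs_def pair_graph_def pair_digraph_def pair_fin_digraph_def by auto
    then have "out_degree (with_proj example) v = (\<Sum>w<10. of_bool ((v, w) \<in> parcs example))"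
      by (simp add: out_degree_def card_image inj_on_def of_bool_def sum.If_cases Int_def)
    moreover have "\<forall>v\<in>{..<10}. (\<Sum>w<10. of_bool ((v, w) \<in> parcs example)) = (3::nat)"
      unfolding ball_lessThan_upt sum_lessThan_upt example_simps by code_simp
    ultimately show ?thesis
      using that by simp
  qed
  then show ?thesis
    by (auto simp: regular_graph_def)
qed

text \<open>From 0 one reaches 1, 2, 3 in one step and the remaining vertices in two; reachability
  is symmetric here.\<close>

lemma connected_example: "connected (with_proj example)"
proof -
  interpret pair_graph example by (rule pair_graph_example)
  have step: "0 \<rightarrow>\<^sup>*\<^bsub>with_proj example\<^esub> v"
    if "0 \<rightarrow>\<^sup>*\<^bsub>with_proj example\<^esub> u" "(u, v) \<in> set example_edges" for u v
    using that by (auto intro: reachable_adj_trans)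
  have 0: "0 \<rightarrow>\<^sup>*\<^bsub>with_proj example\<^esub> 0"
    by (auto simp: reachable_def)
  have 1: "0 \<rightarrow>\<^sup>*\<^bsub>with_proj example\<^esub> 1" "0 \<rightarrow>\<^sup>*\<^bsub>with_proj example\<^esub> 2"
    "0 \<rightarrow>\<^sup>*\<^bsub>with_proj example\<^esub> 3"
    by (rule step[OF 0], simp add: example_edges_def)+
  have "\<forall>v\<in>{..<10}. 0 \<rightarrow>\<^sup>*\<^bsub>with_proj example\<^esub> v"
    unfolding ball_lessThan_upt
    using 0 1 step[OF 1(1), of 4] step[OF 1(1), of 7] step[OF 1(2), of 5] step[OF 1(2), of 8]
      step[OF 1(3), of 6] step[OF 1(3), of 9]
    by (simp add: example_edges_def upt_10)
  then have "u \<rightarrow>\<^sup>*\<^bsub>with_proj example\<^esub> v" if "u < 10" "v < 10" for u v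
    using that symmetric_reachable[OF sym_arcs] reachable_trans by blast
  then show ?thesis
    by (simp add: connected_def strongly_connected_def reachable_mk_symmetric_eq[OF sym_arcs]
        lessThan_empty_iff)
qed

text \<open>
  The vectors are adapted to the swap \<open>4, 5, 6 \<leftrightarrow> 7, 8, 9\<close> and to the
  permutations of the branches \<open>{i, i + 3, i + 6}\<close>, \<open>i = 1, 2, 3\<close>.
\<close>

definition example_vec :: "nat \<Rightarrow> int list" where
  "example_vec j = [
     [1, 1, 1, 1, 1, 1, 1, 1, 1, 1],
     [0, 0, 0, 0, 1, 1, 1, -1, -1, -1],
     [0, 0, 0, 0, 1, -1, 0, -1, 1, 0],
     [0, 0, 0, 0, 1, 1, -2, -1, -1, 2],
     [3, 1, 1, 1, -1, -1, -1, -1, -1, -1],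
     [0, 2, -2, 0, 1, -1, 0, 1, -1, 0],
     [0, 2, 2, -4, 1, 1, -2, 1, 1, -2],
     [6, -4, -4, -4, 1, 1, 1, 1, 1, 1],
     [0, 1, -1, 0, -1, 1, 0, -1, 1, 0],
     [0, 1, 1, -2, -1, -1, 2, -1, -1, 2]] ! j"

definition example_eigenvalue :: "nat \<Rightarrow> int" where
  "example_eigenvalue j = [3, 2, -1, -1, 1, 1, 1, -2, -2, -2] ! j"

text \<open>At both vertices the weights for the eigenvalues 3, 2, -1, 1, -2 are 1/10, 0, 0, 1/2,
  2/5.\<close>

lemma cospectral_example: "cospectral_vertices example 0 1"
proof (rule cospectral_verticesI[where \<psi> = "\<lambda>j v. of_int (example_vec j ! v)"
      and lam = "\<lambda>j. of_int (example_eigenvalue j)"])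
  let ?\<psi> = "\<lambda>j v. of_int (example_vec j ! v) :: real"
  have "\<forall>i\<in>{..<10}. \<forall>j\<in>{..<10}. i \<noteq> j \<longrightarrow> (\<Sum>v<10. example_vec i ! v * example_vec j ! v) = 0"
    unfolding ball_lessThan_upt sum_lessThan_upt by code_simp
  then show "(\<Sum>v\<in>pverts example. ?\<psi> i v * ?\<psi> j v) = 0"
    if "i < card (pverts example)" "j < card (pverts example)" "i \<noteq> j" for i j
    using that by (simp flip: of_int_mult of_int_sum)
  have norms: "\<forall>j\<in>{..<10}. (\<Sum>v<10. (example_vec j ! v)\<^sup>2) = [10, 6, 4, 12, 18, 12, 36, 90, 6, 18] ! j"
    unfolding ball_lessThan_upt sum_lessThan_upt by code_simp
  have norms_pos: "\<forall>j\<in>{..<10}. [10, 6, 4, 12, 18, 12, 36, 90, 6, 18] ! j > (0::int)"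
    unfolding ball_lessThan_upt by code_simp
  show "(\<Sum>v\<in>pverts example. (?\<psi> j v)\<^sup>2) > 0" if "j < card (pverts example)" for j
    using that norms norms_pos by (simp flip: of_int_power of_int_sum)
  have "\<forall>j\<in>{..<10}. \<forall>u\<in>{..<10}. (\<Sum>v<10. of_bool ((u, v) \<in> parcs example) * example_vec j ! v)
      = example_eigenvalue j * example_vec j ! u"
    unfolding ball_lessThan_upt sum_lessThan_upt example_simps
    by code_simp
  \<comment> \<open>Matrix, vectors and eigenvalues are integral, so the eigenvector equation is
    evaluated over the integers and carried over to the reals.\<close>
  moreover have "adj_matrix example u v = of_int (of_bool ((u, v) \<in> parcs example))" for u v
    by (simp add: adj_matrix_def)
  ultimately show "(\<Sum>v\<in>pverts example. adj_matrix example u v * ?\<psi> j v)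
      = of_int (example_eigenvalue j) * ?\<psi> j u"
    if "j < card (pverts example)" "u \<in> pverts example" for j u
    using that by (simp flip: of_int_mult of_int_sum)
  show "(\<Sum>j | j < card (pverts example) \<and> of_int (example_eigenvalue j) = \<mu>.
          (?\<psi> j 0)\<^sup>2 / (\<Sum>v\<in>pverts example. (?\<psi> j v)\<^sup>2))
      = (\<Sum>j | j < card (pverts example) \<and> of_int (example_eigenvalue j) = \<mu>.
          (?\<psi> j 1)\<^sup>2 / (\<Sum>v\<in>pverts example. (?\<psi> j v)\<^sup>2))"
    if \<mu>: "\<mu> \<in> (\<lambda>j. of_int (example_eigenvalue j)) ` {..<card (pverts example)}" for \<mu> :: real
  proof -
    have "(\<Sum>j | j < card (pverts example) \<and> of_int (example_eigenvalue j) = \<mu>.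
        (?\<psi> j u)\<^sup>2 / (\<Sum>v\<in>pverts example. (?\<psi> j v)\<^sup>2))
      = (\<Sum>j<10. if of_int (example_eigenvalue j) = \<mu> then
          of_int ((example_vec j ! u)\<^sup>2) / of_int ([10, 6, 4, 12, 18, 12, 36, 90, 6, 18] ! j) else 0)" for u
      using norms by (subst sum.inter_filter[symmetric]) (auto intro!: sum.cong simp flip: of_int_power of_int_sum)
    \<comment> \<open>This reduces the claim for a real eigenvalue to five identities between
      rational numbers.\<close>
    moreover have "\<forall>j\<in>{..<10}. example_eigenvalue j \<in> {3, 2, -1, 1, -2}"
      unfolding ball_lessThan_upt by code_simp
    then have "\<mu> \<in> {3, 2, -1, 1, -2}"
      using \<mu> by force
    ultimately show ?thesis
      by (auto simp: sum_lessThan_upt upt_10 example_eigenvalue_def example_vec_def)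
  qed
qed

lemma not_similar_example: "\<not> similar_vertices example 0 1"
proof
  assume "similar_vertices example 0 1"
  then obtain f where f: "bij_betw f {..<10} {..<10}" "f 0 = 1"
    and arcs: "\<And>u v. u < 10 \<Longrightarrow> v < 10 \<Longrightarrow> (f u, f v) \<in> parcs example \<longleftrightarrow> (u, v) \<in> parcs example"
    by (auto simp: similar_vertices_def graph_automorphism_def simp del: example_simps(2))
  have preimage: "\<exists>u<10. f u = v" if "v < 10" for v
    using bij_betw_imp_surj_on[OF f(1)] that by (metis imageE lessThan_iff)
  obtain u v w where uvw: "u < 10" "f u = 4" "v < 10" "f v = 5" "w < 10" "f w = 6"
    using preimage[of 4] preimage[of 5] preimage[of 6] by auto
  \<comment> \<open>The vertex 1 has a neighbour in the triangle 4, 5, 6, but 0 has no neighbour in a triangle.\<close>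
  have "(1, 4) \<in> parcs example" "(4, 5) \<in> parcs example" "(4, 6) \<in> parcs example"
    "(5, 6) \<in> parcs example"
    by (simp_all add: example_edges_def)
  then have "(0, u) \<in> parcs example" "(u, v) \<in> parcs example" "(u, w) \<in> parcs example"
    "(v, w) \<in> parcs example"
    using arcs[of 0 u] arcs[of u v] arcs[of u w] arcs[of v w] uvw f(2)
    by (simp_all del: example_simps(2))
  moreover have "\<forall>u\<in>{..<10}. \<forall>v\<in>{..<10}. \<forall>w\<in>{..<10}. \<not> ((0, u) \<in> parcs example \<and>
      (u, v) \<in> parcs example \<and> (u, w) \<in> parcs example \<and> (v, w) \<in> parcs example)"
    unfolding ball_lessThan_upt example_simps by code_simp
  ultimately show False
    using uvw by blast
qed

theorem theorem1p3:
  shows "(\<exists>G :: nat pair_pre_digraph.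
            pair_graph G \<and> connected (with_proj G) \<and> regular_graph G \<and> card (pverts G) = 10 \<and>
            (\<exists>a \<in> pverts G. \<exists>b \<in> pverts G.
               cospectral_vertices G a b \<and> \<not> similar_vertices G a b)) \<and>
         \<not> (\<exists>G :: 'a pair_pre_digraph.
            pair_graph G \<and> connected (with_proj G) \<and> regular_graph G \<and> card (pverts G) < 10 \<and>
            (\<exists>a \<in> pverts G. \<exists>b \<in> pverts G.
               cospectral_vertices G a b \<and> \<not> similar_vertices G a b))"
proof (rule conjI)
  have "\<exists>a \<in> pverts example. \<exists>b \<in> pverts example.
      cospectral_vertices example a b \<and> \<not> similar_vertices example a b"
  proof (rule bexI[of _ 0], rule bexI[of _ 1])
    show "cospectral_vertices example 0 1 \<and> \<not> similar_vertices example 0 1"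
      using cospectral_example not_similar_example by (rule conjI)
  qed simp_all
  moreover have "card (pverts example) = 10"
    by simp
  ultimately show "\<exists>G :: nat pair_pre_digraph.
      pair_graph G \<and> connected (with_proj G) \<and> regular_graph G \<and> card (pverts G) = 10 \<and>
      (\<exists>a \<in> pverts G. \<exists>b \<in> pverts G. cospectral_vertices G a b \<and> \<not> similar_vertices G a b)"
    using pair_graph_example connected_example regular_example
    by (intro exI[of _ example] conjI)
next
  show "\<not> (\<exists>G :: 'a pair_pre_digraph.
      pair_graph G \<and> connected (with_proj G) \<and> regular_graph G \<and> card (pverts G) < 10 \<and>
      (\<exists>a \<in> pverts G. \<exists>b \<in> pverts G. cospectral_vertices G a b \<and> \<not> similar_vertices G a b))"
  proof (rule notI, elim exE conjE bexE)
    fix G :: "'a pair_pre_digraph" and a b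
    assume "pair_graph G" "regular_graph G" "card (pverts G) < 10" "a \<in> pverts G" "b \<in> pverts G"
      "cospectral_vertices G a b" "\<not> similar_vertices G a b"
    then show False
      using cospectral_imp_similar by (elim notE)
  qed
qed

end
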